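(* Let $k\ge 2$ be a (finite) integer. Then there exists a constant $c(k)>0$ such that for all integers $n\ge 2$, \[c(k)\,\frac{n}{\log_2 n}\le c_{(D,k)}(T_n)\le 2n,\] where $T_n$ is the binary tree of depth $n$ and $c_{(D,k)}(T_n)$ is the distortion of embeddings of $T_n$ into the sequence $\{D_{m,k}\}_{m=1}^\infty$ of diamonds of branching $k$.
   Context: All graphs are identified with their vertex sets endowed with the shortest path distance (the distance between two vertices is the number of edges in a shortest path between them). Binary tree: the binary tree $T_n$ of depth $n$ is the finite graph whose vertices are the finite (possibly empty) sequences of $0$'s and $1$'s of length at most $n$; two vertices are adjacent if the sequence representing one of them is obtained from the sequence representing the other by adding one term on the right. Diamonds of branching $k$: $D_{0,k}$ is a graph consisting of two vertices joined by one edge. The graph $D_{m+1,k}$ is obtained from $D_{m,k}$ by replacing each edge $uv$ of $D_{m,k}$ by a set of $k$ paths of length $2$ joining $u$ and $v$ (the midpoints of these paths are new vertices, all distinct, and distinct for distinct edges). Distortion: let $M$ be a finite metric space and $\{R_m\}_{m=1}^\infty$ a sequence of metric spaces. The distortion of embeddings of $M$ into $\{R_m\}_{m=1}^\infty$ is the infimum of those $C\ge 1$ for which there exist $m\in\mathbb{N}$, a map $f:M\to R_m$, and a number $r>0$ such that \[\forall u,v\in M\quad r\,d_M(u,v)\le d_{R_m}(f(u),f(v))\le rC\,d_M(u,v).\] $c_{(D,k)}(M)$ denotes this quantity for $R_m=D_{m,k}$. *)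

theory Defs
  imports "HOL-Analysis.Abstract_Metric_Spaces" "Graph_Theory.Graph_Theory"
begin

text \<open>
  Simple undirected graphs are symmetric digraphs without loops or parallel arcs
  (locale \<^locale>\<open>pair_graph\<close>).  The distance is the weighted shortest-walk distance of
  the library for the weight that is 1 on every arc; \<^const>\<open>real_of_ereal\<close> is harmless because
  it is finite in connected graphs (see \<open>graph_dist_eq\<close> below).
\<close>

definition graph_dist :: "'a pair_pre_digraph \<Rightarrow> 'a \<Rightarrow> 'a \<Rightarrow> real" where
  "graph_dist G u v = real_of_ereal (wf_digraph.\<mu> (with_proj G) (\<lambda>_. 1) u v)"

definition graph_metric :: "'a pair_pre_digraph \<Rightarrow> 'a metric" where
  "graph_metric G = metric (pverts G, graph_dist G)"

lemma (in wf_digraph) awalk_cost_one: "awalk_cost (\<lambda>_. 1) p = real (length p)"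
  by (induction p) auto

lemma ex_shortest_path:
  assumes "pair_graph G" "strongly_connected (with_proj G)" "u \<in> pverts G" "v \<in> pverts G"
  shows "\<exists>p. pre_digraph.apath (with_proj G) u p v \<and> graph_dist G u v = real (length p)"
proof -
  interpret pair_graph G by fact
  have "u \<rightarrow>\<^sup>*\<^bsub>with_proj G\<^esub> v"
    using assms unfolding strongly_connected_def by auto
  from min_cost_awalk[OF this, of "\<lambda>_. 1"] show ?thesis
    by (auto simp: graph_dist_def awalk_cost_one)
qed

lemma graph_dist_le:
  assumes "pair_graph G" "strongly_connected (with_proj G)"
    and "pre_digraph.awalk (with_proj G) u p v"
  shows "graph_dist G u v \<le> real (length p)"
proof -
  interpret pair_graph G by fact
  have "u \<rightarrow>\<^sup>*\<^bsub>with_proj G\<^esub> v"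
    using assms(3) reachable_awalkI by blast
  from min_cost_awalk[OF this, of "\<lambda>_. 1"] obtain q where
    q: "\<mu> (\<lambda>_. 1) u v = ereal (awalk_cost (\<lambda>_. 1) q)"
    by auto
  show ?thesis
    using min_cost_le_walk_cost[OF assms(3), of "\<lambda>_. 1"] q
    by (simp add: graph_dist_def awalk_cost_one)
qed

lemma graph_dist_eq:
  assumes "pair_graph G" "strongly_connected (with_proj G)" "u \<in> pverts G" "v \<in> pverts G"
  shows "graph_dist G u v =
    real (LEAST l. \<exists>p. pre_digraph.apath (with_proj G) u p v \<and> length p = l)"
proof -
  obtain p where p: "pre_digraph.apath (with_proj G) u p v" "graph_dist G u v = real (length p)"
    using ex_shortest_path[OF assms] by blast
  have "(LEAST l. \<exists>p. pre_digraph.apath (with_proj G) u p v \<and> length p = l) = length p"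
  proof (rule Least_equality)
    fix l assume "\<exists>p. pre_digraph.apath (with_proj G) u p v \<and> length p = l"
    then show "length p \<le> l"
      using graph_dist_le[OF assms(1,2)] p(2) by (fastforce simp: pre_digraph.apath_def)
  qed (use p in blast)
  with p show ?thesis by simp
qed

lemma Metric_space_graph_dist:
  assumes "pair_graph G" "strongly_connected (with_proj G)"
  shows "Metric_space (pverts G) (graph_dist G)"
proof -
  interpret pair_graph G by fact
  note ex = ex_shortest_path[OF assms] and le = graph_dist_le[OF assms]
  have le_sym: "graph_dist G x y \<le> graph_dist G y x" if xy: "x \<in> pverts G" "y \<in> pverts G" for x y
  proof -
    obtain p where p: "apath y p x" "graph_dist G y x = real (length p)"
      using ex[OF xy(2,1)] by blast
    have "awalk x (rev (map (\<lambda>(a,b). (b,a)) q)) y" if "awalk y q x" for q y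
      using that
    proof (induction q arbitrary: y)
      case Nil then show ?case by (auto simp: awalk_Nil_iff)
    next
      case (Cons e q)
      obtain a b where e: "e = (a, b)" by force
      have *: "(a, b) \<in> parcs G" "y = a" "awalk b q x"
        using Cons.prems by (auto simp: e awalk_Cons_iff)
      moreover have "(b, a) \<in> parcs G"
        using *(1) pair_sym_arcs by (auto simp: symmetric_def dest: symD)
      ultimately have "awalk b [(b, a)] a"
        using arc_fst_in_verts arc_snd_in_verts by (force simp: awalk_Cons_iff awalk_Nil_iff)
      with Cons.IH[OF *(3)] show ?case
        using *(2) awalk_appendI by (force simp: e)
    qed
    from this[of y p] p(1) have "awalk x (rev (map (\<lambda>(a,b). (b,a)) p)) y"
      by (simp add: apath_def)
    from le[OF this] p(2) show ?thesis by simp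
  qed
  show ?thesis
  proof
    show "0 \<le> graph_dist G x y" for x y
    proof -
      have "0 \<le> \<mu> (\<lambda>_. 1) x y"
        unfolding \<mu>_def by (intro INF_greatest) (auto simp: awalk_cost_one)
      then show ?thesis by (simp add: graph_dist_def real_of_ereal_pos)
    qed
    show "graph_dist G x y = graph_dist G y x" for x y
    proof (cases "x \<in> pverts G \<and> y \<in> pverts G")
      case True
      then show ?thesis using le_sym[of x y] le_sym[of y x] by simp
    next
      case False
      then have "{p. awalk x p y} = {}" "{p. awalk y p x} = {}"
        by auto
      then show ?thesis by (simp add: graph_dist_def \<mu>_def)
    qed
    show "graph_dist G x y = 0 \<longleftrightarrow> x = y" if xy: "x \<in> pverts G" "y \<in> pverts G" for x y
    proof
      assume "graph_dist G x y = 0"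
      then obtain p where "apath x p y" "length p = 0" using ex[OF xy] by auto
      then show "x = y" by (simp add: apath_def awalk_Nil_iff)
    next
      assume "x = y"
      then have "awalk x [] y" using xy by (simp add: awalk_Nil_iff)
      from le[OF this] \<open>0 \<le> graph_dist G x y\<close> show "graph_dist G x y = 0" by simp
    qed
    show "graph_dist G x z \<le> graph_dist G x y + graph_dist G y z"
      if xyz: "x \<in> pverts G" "y \<in> pverts G" "z \<in> pverts G" for x y z
    proof -
      obtain p q where "apath x p y" "graph_dist G x y = real (length p)"
        "apath y q z" "graph_dist G y z = real (length q)"
        using ex xyz by metis
      moreover from this have "awalk x (p @ q) z" by (auto simp: apath_def)
      ultimately show ?thesis using le[of x "p @ q" z] by simp
    qed
  qed
qed

lemma
  assumes "pair_graph G" "strongly_connected (with_proj G)"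
  shows mspace_graph_metric: "mspace (graph_metric G) = pverts G"
    and mdist_graph_metric: "mdist (graph_metric G) = graph_dist G"
  using Metric_space_graph_dist[OF assms]
  by (simp_all add: graph_metric_def Metric_space.mspace_metric Metric_space.mdist_metric)

definition binary_tree :: "nat \<Rightarrow> bool list pair_pre_digraph" where
  "binary_tree n =
    \<lparr> pverts = {s. length s \<le> n},
      parcs = {(s, t). length s \<le> n \<and> length t \<le> n \<and> (\<exists>b. t = s @ [b] \<or> s = t @ [b])} \<rparr>"

text \<open>
  \<open>Mid u v i\<close> is the midpoint of the \<open>i\<close>-th of the paths replacing the edge \<open>uv\<close>.  To name
  each midpoint only once, every edge carries one orientation (away from \<open>Bottom\<close>, towards
  \<open>Top\<close>), which is forgotten in \<open>diamond\<close>.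
  The midpoints of one step are new vertices by \<open>Mid_fresh\<close>, and no edge occurs in both
  orientations by \<open>diamond_edges_asym\<close>.
\<close>

datatype dvertex = Bottom | Top | Mid dvertex dvertex nat

fun diamond_edges :: "nat \<Rightarrow> nat \<Rightarrow> (dvertex \<times> dvertex) set" where
  "diamond_edges k 0 = {(Bottom, Top)}"
| "diamond_edges k (Suc m) =
    (\<Union>(u, v) \<in> diamond_edges k m. \<Union>i<k. {(u, Mid u v i), (Mid u v i, v)})"

fun diamond_verts :: "nat \<Rightarrow> nat \<Rightarrow> dvertex set" where
  "diamond_verts k 0 = {Bottom, Top}"
| "diamond_verts k (Suc m) =
    diamond_verts k m \<union> {Mid u v i | u v i. (u, v) \<in> diamond_edges k m \<and> i < k}"

definition diamond :: "nat \<Rightarrow> nat \<Rightarrow> dvertex pair_pre_digraph" where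
  "diamond k m =
    \<lparr> pverts = diamond_verts k m, parcs = diamond_edges k m \<union> (diamond_edges k m)\<inverse> \<rparr>"

text \<open>The infimum is taken in \<^typ>\<open>ereal\<close>, so that it is \<open>\<infinity>\<close> if there is no such \<open>C\<close>.\<close>

definition distortion :: "'a metric \<Rightarrow> (nat \<Rightarrow> 'b metric) \<Rightarrow> ereal" where
  "distortion M R = Inf {ereal C | C. 1 \<le> C \<and>
    (\<exists>m\<ge>1. \<exists>f r. f ` mspace M \<subseteq> mspace (R m) \<and> 0 < r \<and>
      (\<forall>u\<in>mspace M. \<forall>v\<in>mspace M.
        r * mdist M u v \<le> mdist (R m) (f u) (f v) \<and>
        mdist (R m) (f u) (f v) \<le> r * C * mdist M u v))}"

definition diamond_distortion :: "nat \<Rightarrow> 'a metric \<Rightarrow> ereal" where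
  "diamond_distortion k M = distortion M (\<lambda>m. graph_metric (diamond k m))"

lemma strongly_connectedI_root:
  assumes "pair_graph G" "r \<in> pverts G" "\<And>v. v \<in> pverts G \<Longrightarrow> r \<rightarrow>\<^sup>*\<^bsub>with_proj G\<^esub> v"
  shows "strongly_connected (with_proj G)"
proof -
  interpret pair_graph G by fact
  show ?thesis
    unfolding strongly_connected_def
    using assms(2,3) symmetric_reachable[OF pair_sym_arcs] reachable_trans
    by (metis empty_iff with_proj_simps(1))
qed

lemma pair_graph_binary_tree: "pair_graph (binary_tree n)"
proof
  have "finite {s :: bool list. length s \<le> n}"
    using finite_lists_length_le[of "UNIV :: bool set" n] by simp
  then show fin: "finite (pverts (binary_tree n))" by (simp add: binary_tree_def)
  have "parcs (binary_tree n) \<subseteq> pverts (binary_tree n) \<times> pverts (binary_tree n)"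
    by (auto simp: binary_tree_def)
  then show "finite (parcs (binary_tree n))"
    by (rule finite_subset) (simp add: fin)
qed (auto simp: binary_tree_def symmetric_def sym_def)

lemma connected_binary_tree: "strongly_connected (with_proj (binary_tree n))"
proof (rule strongly_connectedI_root[OF pair_graph_binary_tree])
  interpret pair_graph "binary_tree n" by (rule pair_graph_binary_tree)
  show "[] \<in> pverts (binary_tree n)" by (simp add: binary_tree_def)
  show "[] \<rightarrow>\<^sup>*\<^bsub>with_proj (binary_tree n)\<^esub> s" if "s \<in> pverts (binary_tree n)" for s
    using that
  proof (induction s rule: rev_induct)
    case Nil
    then show ?case by (simp add: reachable_refl)
  next
    case (snoc b s)
    then have "(s, s @ [b]) \<in> parcs (binary_tree n)" "s \<in> pverts (binary_tree n)"
      by (auto simp: binary_tree_def)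
    with snoc.IH show ?case
      by (meson reachable_adj_trans with_proj_simps(3) reachable_trans reachable_adjI)
  qed
qed

fun dvertex_level :: "dvertex \<Rightarrow> nat" where
  "dvertex_level Bottom = 0"
| "dvertex_level Top = 0"
| "dvertex_level (Mid u v i) = Suc (max (dvertex_level u) (dvertex_level v))"

lemma diamond_edges_level:
  "(u, v) \<in> diamond_edges k m \<Longrightarrow> max (dvertex_level u) (dvertex_level v) = m"
  by (induction m arbitrary: u v) fastforce+

lemma diamond_verts_level: "w \<in> diamond_verts k m \<Longrightarrow> dvertex_level w \<le> m"
  by (induction m arbitrary: w) (fastforce dest: diamond_edges_level)+

lemma Mid_fresh: "(u, v) \<in> diamond_edges k m \<Longrightarrow> Mid u v i \<notin> diamond_verts k m"
  using diamond_edges_level[of u v k m] diamond_verts_level[of "Mid u v i" k m] by auto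

lemma diamond_edges_verts:
  "(u, v) \<in> diamond_edges k m \<Longrightarrow> u \<in> diamond_verts k m \<and> v \<in> diamond_verts k m"
  by (induction m arbitrary: u v) fastforce+

lemma diamond_edges_neq: "(u, v) \<in> diamond_edges k m \<Longrightarrow> u \<noteq> v"
proof (induction m arbitrary: u v)
  case (Suc m)
  then show ?case using diamond_edges_verts Mid_fresh by fastforce
qed simp

lemma diamond_edges_asym: "(u, v) \<in> diamond_edges k m \<Longrightarrow> (v, u) \<notin> diamond_edges k m"
proof (cases m)
  case (Suc m')
  assume uv: "(u, v) \<in> diamond_edges k m"
  show ?thesis
  proof
    assume vu: "(v, u) \<in> diamond_edges k m"
    have *: False if
      "(a, b) \<in> diamond_edges k m'" "(c, d) \<in> diamond_edges k m'"
      "(x, y) = (a, Mid a b i)" "(y, x) = (c, Mid c d j) \<or> (y, x) = (Mid c d j, d)" for a b c d i j x y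
    proof -
      have "a = b"
        using that diamond_edges_verts[OF that(1)] diamond_edges_verts[OF that(2)]
          Mid_fresh[OF that(1)] Mid_fresh[OF that(2)] by auto
      with diamond_edges_neq[OF that(1)] show False by simp
    qed
    have **: "\<not> ((x, y) = (Mid a b i, b) \<and> (y, x) = (Mid c d j, d))"
      if "(a, b) \<in> diamond_edges k m'" "(c, d) \<in> diamond_edges k m'" for a b c d i j x y
      using diamond_edges_verts[OF that(2)] Mid_fresh[OF that(1)] by auto
    from uv vu show False
      unfolding Suc by (clarsimp) (metis * **)
  qed
qed simp

lemma finite_diamond_edges: "finite (diamond_edges k m)"
  by (induction m) auto

lemma finite_diamond_verts: "finite (diamond_verts k m)"
proof (induction m)
  case (Suc m)
  have "{Mid u v i | u v i. (u, v) \<in> diamond_edges k m \<and> i < k} =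
      (\<lambda>((u, v), i). Mid u v i) ` (diamond_edges k m \<times> {..<k})"
    by force
  then show ?case using Suc finite_diamond_edges by simp
qed simp

lemma pair_graph_diamond: "pair_graph (diamond k m)"
proof
  show "symmetric (with_proj (diamond k m))"
    by (auto simp: diamond_def symmetric_def sym_def)
qed (auto simp: diamond_def finite_diamond_verts finite_diamond_edges
  dest: diamond_edges_verts diamond_edges_neq)

lemma connected_diamond:
  assumes "k \<ge> 1"
  shows "strongly_connected (with_proj (diamond k m))"
proof (rule strongly_connectedI_root[OF pair_graph_diamond])
  show Bottom: "Bottom \<in> pverts (diamond k m)" for m
    by (induction m) (auto simp: diamond_def)
  show "Bottom \<rightarrow>\<^sup>*\<^bsub>with_proj (diamond k m)\<^esub> w" if "w \<in> pverts (diamond k m)" for w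
    using that
  proof (induction m arbitrary: w)
    case 0
    interpret pair_graph "diamond k 0" by (rule pair_graph_diamond)
    have "(Bottom, Top) \<in> parcs (diamond k 0)" by (simp add: diamond_def)
    moreover have "w = Bottom \<or> w = Top" using 0 by (simp add: diamond_def)
    ultimately show ?case
      using Bottom[of 0] by (auto simp: reachable_adjI reachable_refl)
  next
    case (Suc m)
    interpret G: pair_graph "diamond k m" by (rule pair_graph_diamond)
    interpret H: pair_graph "diamond k (Suc m)" by (rule pair_graph_diamond)
    have mid: "(u, Mid u v i) \<in> parcs (diamond k (Suc m))" "(Mid u v i, v) \<in> parcs (diamond k (Suc m))"
      "(v, Mid u v i) \<in> parcs (diamond k (Suc m))" "(Mid u v i, u) \<in> parcs (diamond k (Suc m))"
      if "(u, v) \<in> diamond_edges k m" "i < k" for u v i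
      using that by (fastforce simp: diamond_def)+
    have adj: "x \<rightarrow>\<^sup>*\<^bsub>with_proj (diamond k (Suc m))\<^esub> y" if "(x, y) \<in> parcs (diamond k m)" for x y
    proof -
      have "(x, y) \<in> diamond_edges k m \<or> (y, x) \<in> diamond_edges k m"
        using that by (auto simp: diamond_def)
      then obtain z where "(x, z) \<in> parcs (diamond k (Suc m))" "(z, y) \<in> parcs (diamond k (Suc m))"
        using mid[of _ _ 0] assms by (metis less_eq_Suc_le One_nat_def)
      then show ?thesis
        by (metis H.reachable_adjI H.reachable_trans with_proj_simps(3))
    qed
    have lift: "Bottom \<rightarrow>\<^sup>*\<^bsub>with_proj (diamond k (Suc m))\<^esub> x" if "x \<in> pverts (diamond k m)" for x
    proof -
      have "Bottom \<rightarrow>\<^sup>*\<^bsub>with_proj (diamond k m)\<^esub> x" using Suc.IH that .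
      then have "(Bottom, x) \<in> (parcs (diamond k m))\<^sup>*"
        by (metis reachable_rtranclI with_proj_simps(3))
      then show ?thesis
      proof (induction rule: rtrancl_induct)
        case base
        then show ?case using Bottom[of "Suc m"] by (simp add: H.reachable_refl)
      next
        case (step y z)
        then show ?case using adj H.reachable_trans by blast
      qed
    qed
    show ?case
    proof (cases "w \<in> pverts (diamond k m)")
      case True
      then show ?thesis by (rule lift)
    next
      case False
      with Suc.prems obtain u v i where
        w: "w = Mid u v i" "(u, v) \<in> diamond_edges k m" "i < k"
        by (auto simp: diamond_def)
      then have "u \<in> pverts (diamond k m)"
        using diamond_edges_verts by (auto simp: diamond_def)
      with lift mid(1)[OF w(2,3)] w(1) show ?thesis
        by (metis H.reachable_adjI H.reachable_trans with_proj_simps(3))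
    qed
  qed
qed

end

theory Submission
  imports Defs "HOL-Real_Asymp.Real_Asymp"
begin

text \<open>
  Upper bound: the neighbours of \<^term>\<open>Bottom\<close> in a large diamond are pairwise at distance 2, so any
  injection of the tree into them has distortion at most \<open>2 n\<close>.

  Lower bound: let \<open>f\<close> embed the tree with constants \<open>r\<close> and \<open>C\<close>, where \<open>C < n / 4\<close>.  Choose \<open>j\<close> with \<open>2 ^ j\<close>
  slightly above the diameter \<open>\<approx> r C n\<close> of the image.  The vertices of \<open>D\<^sub>m\<^sub>-\<^sub>j\<close> are
  \<open>2 ^ j\<close>-separated in \<open>D\<^sub>m\<close>, so at most one of them lies near the image, and the tree vertices that
  \<open>f\<close> maps to within \<open>r C\<close> of it have mutual distance at most \<open>2 C\<close>.  Hence one of two subtrees whose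
  roots have depth just above \<open>C\<close>, in opposite halves of the tree, avoids all of them.  The image of an
  edge has length at most \<open>r C\<close>, so the image of that subtree cannot leave a single cell, i.e. the
  subdivision of one edge of \<open>D\<^sub>m\<^sub>-\<^sub>j\<close>.  At resolution \<open>r\<close> a cell only has polynomially many points in
  \<open>n\<close>, whereas the subtree has more than \<open>2 ^ (n / 2)\<close> leaves.  This even yields a linear lower
  bound for large \<open>n\<close>.
\<close>

section \<open>Distances in graphs\<close>

locale connected_pair_graph = pair_graph G for G :: "'a pair_pre_digraph" (structure) +
  assumes connected: "strongly_connected (with_proj G)"
begin

sublocale M: Metric_space "pverts G" "graph_dist G"
  by (rule Metric_space_graph_dist[OF pair_graph_axioms connected])

lemma obtain_geodesic:
  assumes "u \<in> pverts G" "v \<in> pverts G"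
  obtains p where "awalk u p v" "graph_dist G u v = real (length p)"
  using ex_shortest_path[OF pair_graph_axioms connected assms] by (auto simp: apath_def)

lemma graph_dist_le_length: "awalk u p v \<Longrightarrow> graph_dist G u v \<le> real (length p)"
  using graph_dist_le[OF pair_graph_axioms connected] by simp

lemma graph_dist_arc_le_1:
  assumes "(u, v) \<in> parcs G"
  shows "graph_dist G u v \<le> 1"
proof -
  have "awalk u [(u, v)] v"
    using assms arc_fst_in_verts arc_snd_in_verts by (force simp: awalk_Cons_iff awalk_Nil_iff)
  from graph_dist_le_length[OF this] show ?thesis by simp
qed

lemma graph_dist_ge_1:
  assumes "u \<in> pverts G" "v \<in> pverts G" "u \<noteq> v"
  shows "1 \<le> graph_dist G u v"
proof -
  obtain p where p: "awalk u p v" "graph_dist G u v = real (length p)"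
    using obtain_geodesic assms by blast
  with assms(3) show ?thesis by (cases p) (auto simp: awalk_Nil_iff)
qed

lemma graph_dist_ge_2:
  assumes "u \<in> pverts G" "v \<in> pverts G" "u \<noteq> v" "(u, v) \<notin> parcs G"
  shows "2 \<le> graph_dist G u v"
proof -
  obtain p where p: "awalk u p v" "graph_dist G u v = real (length p)"
    using obtain_geodesic assms by blast
  consider "p = []" | e where "p = [e]" | e e' q where "p = e # e' # q"
    by (metis list.exhaust)
  then show ?thesis
  proof cases
    case 2
    with p(1) assms(4) show ?thesis by (cases e) (auto simp: awalk_Cons_iff awalk_Nil_iff)
  qed (use p assms(3) in \<open>auto simp: awalk_Nil_iff\<close>)
qed

text \<open>The variation of \<open>g\<close> is summed along a geodesic. Lower bounds on long
  distances are obtained from this: the test function is the signed depth in the tree and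
  \<open>potential\<close> in the diamond.\<close>

lemma lipschitz_graph_dist:
  fixes g :: "'a \<Rightarrow> real"
  assumes lip: "\<And>x y. (x, y) \<in> parcs G \<Longrightarrow> \<bar>g x - g y\<bar> \<le> L"
    and "u \<in> pverts G" "v \<in> pverts G"
  shows "\<bar>g u - g v\<bar> \<le> L * graph_dist G u v"
proof -
  obtain p where p: "awalk u p v" "graph_dist G u v = real (length p)"
    using obtain_geodesic assms(2,3) by blast
  have "\<bar>g u - g v\<bar> \<le> L * real (length p)"
    using p(1)
  proof (induction p arbitrary: u)
    case (Cons e p)
    obtain w where e: "e = (u, w)" "(u, w) \<in> parcs G" "awalk w p v"
      using Cons.prems by (cases e) (auto simp: awalk_Cons_iff)
    show ?case
      using Cons.IH[OF e(3)] lip[OF e(2)] by (simp add: algebra_simps)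
  qed (auto simp: awalk_Nil_iff)
  with p(2) show ?thesis by simp
qed

end

section \<open>Binary trees\<close>

locale binary_tree_graph = fixes n :: nat
begin

sublocale connected_pair_graph "binary_tree n"
  by (intro connected_pair_graph.intro connected_pair_graph_axioms.intro
    pair_graph_binary_tree connected_binary_tree)

lemma verts_iff [simp]: "s \<in> pverts (binary_tree n) \<longleftrightarrow> length s \<le> n"
  by (simp add: binary_tree_def)

lemma child_arc: "length s < n \<Longrightarrow> (s, s @ [b]) \<in> parcs (binary_tree n)"
  by (simp add: binary_tree_def)

lemma dist_root_le:
  "length s \<le> n \<Longrightarrow> graph_dist (binary_tree n) [] s \<le> real (length s)"
proof (induction s rule: rev_induct)
  case (snoc b s)
  then show ?case
    using M.triangle[of "[]" s "s @ [b]"] graph_dist_arc_le_1[OF child_arc[of s b]] by simp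
qed (simp add: M.zero)

lemma dist_le: 
  assumes "length s \<le> n" "length t \<le> n"
  shows "graph_dist (binary_tree n) s t \<le> 2 * real n"
  using M.triangle[of s "[]" t] dist_root_le[of s] dist_root_le[of t] M.commute[of s "[]"] assms
  by simp

text \<open>The signed depth, positive in one half of the tree and negative in the other, is 1-Lipschitz.\<close>

lemma dist_opposite_ge:
  assumes "length s \<le> n" "length t \<le> n" "s \<noteq> []" "t \<noteq> []" "hd s \<noteq> hd t"
  shows "real (length s) + real (length t) \<le> graph_dist (binary_tree n) s t"
proof -
  define g where "g s = (if s \<noteq> [] \<and> hd s then real (length s) else - real (length s))"
    for s :: "bool list"
  have "\<bar>g x - g y\<bar> \<le> 1" if "(x, y) \<in> parcs (binary_tree n)" for x y
    using that by (auto simp: binary_tree_def g_def hd_append split: if_splits)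
  from lipschitz_graph_dist[of g 1 s t, OF this] assms show ?thesis
    by (auto simp: g_def split: if_splits)
qed

end

section \<open>Cells of diamonds\<close>

text \<open>One step of the diamond construction for an arbitrary set of edges, so that iterating it
  on a single edge produces the cell which grows out of that edge.\<close>

definition subdiv :: "nat \<Rightarrow> (dvertex \<times> dvertex) set \<Rightarrow> (dvertex \<times> dvertex) set" where
  "subdiv k E = (\<Union>(u, v)\<in>E. \<Union>i<k. {(u, Mid u v i), (Mid u v i, v)})"

lemma subdivE:
  assumes "(x, y) \<in> subdiv k E"
  obtains a b i where "(a, b) \<in> E" "i < k" "(x, y) = (a, Mid a b i) \<or> (x, y) = (Mid a b i, b)"
  using assms by (fastforce simp: subdiv_def)

lemma diamond_edges_add: "diamond_edges k (l + j) = (subdiv k ^^ j) (diamond_edges k l)"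
  by (induction j) (simp_all add: subdiv_def)

lemma subdiv_pow_UN: "(subdiv k ^^ j) E = (\<Union>e\<in>E. (subdiv k ^^ j) {e})"
proof (induction j)
  case (Suc j)
  have UN: "subdiv k (\<Union>e\<in>E. F e) = (\<Union>e\<in>E. subdiv k (F e))" for F
    by (auto simp: subdiv_def)
  have "(subdiv k ^^ Suc j) E = subdiv k (\<Union>e\<in>E. (subdiv k ^^ j) {e})"
    using Suc by simp
  with UN show ?case by simp
qed simp

lemma Field_subset_subdiv:
  assumes "k \<ge> 1"
  shows "Field E \<subseteq> Field (subdiv k E)"
proof
  fix w assume "w \<in> Field E"
  then obtain u v where uv: "(u, v) \<in> E" "w = u \<or> w = v"
    by (auto simp: Field_def)
  have "(u, Mid u v 0) \<in> subdiv k E" "(Mid u v 0, v) \<in> subdiv k E"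
    using uv(1) assms by (fastforce simp: subdiv_def)+
  with uv(2) show "w \<in> Field (subdiv k E)"
    by (auto simp: Field_def)
qed

lemma Field_subset_subdiv_pow: "k \<ge> 1 \<Longrightarrow> Field E \<subseteq> Field ((subdiv k ^^ j) E)"
  by (induction j) (use Field_subset_subdiv in \<open>auto simp del: One_nat_def\<close>)

lemma diamond_edges_Suc: "diamond_edges k (Suc m) = subdiv k (diamond_edges k m)"
  by (simp add: subdiv_def)

lemma Field_subdiv_pow: "Field ((subdiv k ^^ j) E) = (\<Union>e\<in>E. Field ((subdiv k ^^ j) {e}))"
  by (subst subdiv_pow_UN) (auto simp: Field_def)

lemma diamond_edges_cells:
  assumes "l \<le> m"
  shows "diamond_edges k m = (\<Union>e\<in>diamond_edges k l. (subdiv k ^^ (m - l)) {e})"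
  by (metis assms diamond_edges_add le_add_diff_inverse subdiv_pow_UN)

lemma finite_card_subdiv:
  assumes "finite E"
  shows "finite (subdiv k E)" "card (subdiv k E) \<le> 2 * k * card E"
proof -
  have eq: "subdiv k E = (\<Union>(e, i)\<in>E \<times> {..<k}. {(fst e, Mid (fst e) (snd e) i), (Mid (fst e) (snd e) i, snd e)})"
    by (auto simp: subdiv_def)
  show "finite (subdiv k E)" unfolding eq using assms by auto
  have "card (subdiv k E) \<le> (\<Sum>p\<in>E \<times> {..<k}. 2)"
    unfolding eq using assms
    by (intro order_trans[OF card_UN_le] sum_mono) (auto simp: card_insert_if)
  then show "card (subdiv k E) \<le> 2 * k * card E" by (simp add: card_cartesian_product mult_ac)
qed

lemma finite_subdiv_pow: "finite E \<Longrightarrow> finite ((subdiv k ^^ j) E)"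
  by (induction j) (simp_all add: finite_card_subdiv)

lemma card_subdiv_pow: "card ((subdiv k ^^ j) {e}) \<le> (2 * k) ^ j"
proof (induction j)
  case (Suc j)
  have "card ((subdiv k ^^ Suc j) {e}) \<le> 2 * k * card ((subdiv k ^^ j) {e})"
    using finite_card_subdiv(2)[of "(subdiv k ^^ j) {e}" k] by (simp add: finite_subdiv_pow)
  also have "\<dots> \<le> 2 * k * (2 * k) ^ j" using Suc by (rule mult_left_mono) simp
  finally show ?case by simp
qed simp

section \<open>Levels of vertices and decomposition into cells\<close>

lemma diamond_verts_mono: "l \<le> m \<Longrightarrow> diamond_verts k l \<subseteq> diamond_verts k m"
  by (induction m) (auto simp: le_Suc_eq)

text \<open>The level of a vertex is the step at which it is created, because one endpoint of every
  edge of the \<open>m\<close>-th diamond has level exactly \<open>m\<close>.\<close>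

lemma diamond_verts_low_level: "w \<in> diamond_verts k m \<Longrightarrow> dvertex_level w \<le> l \<Longrightarrow> l \<le> m \<Longrightarrow> w \<in> diamond_verts k l"
proof (induction m)
  case (Suc m)
  then show ?case
    by (auto simp: le_Suc_eq) (fastforce dest: diamond_edges_level)+
qed simp

lemma Field_diamond_edges:
  assumes "k \<ge> 1"
  shows "Field (diamond_edges k m) = diamond_verts k m"
proof
  show "Field (diamond_edges k m) \<subseteq> diamond_verts k m"
    by (auto simp: Field_def dest: diamond_edges_verts)
  show "diamond_verts k m \<subseteq> Field (diamond_edges k m)"
  proof (induction m)
    case (Suc m)
    have "Field (diamond_edges k m) \<subseteq> Field (diamond_edges k (Suc m))"
      using Field_subset_subdiv[OF assms] by (simp only: diamond_edges_Suc)
    moreover have "Mid u v i \<in> Field (diamond_edges k (Suc m))"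
      if "(u, v) \<in> diamond_edges k m" "i < k" for u v i
      using that by (force simp: Field_def)
    ultimately show ?case using Suc by auto
  qed (simp add: Field_def)
qed

lemma diamond_verts_cells:
  assumes "k \<ge> 1" "l \<le> m"
  shows "diamond_verts k m = (\<Union>e\<in>diamond_edges k l. Field ((subdiv k ^^ (m - l)) {e}))"
  using Field_diamond_edges[OF assms(1), of m] diamond_edges_add[of k l "m - l"] assms(2)
    Field_subdiv_pow[of "m - l" k "diamond_edges k l"] by simp

text \<open>The edge of the \<open>l\<close>-th diamond whose subdivision contains the given vertex; meaningful only
  for vertices of level above \<open>l\<close>.\<close>

fun cell_of :: "nat \<Rightarrow> dvertex \<Rightarrow> dvertex \<times> dvertex" where
  "cell_of l (Mid u v i) =
    (if max (dvertex_level u) (dvertex_level v) = l then (u, v)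
     else if dvertex_level u < dvertex_level v then cell_of l v else cell_of l u)"
| "cell_of l _ = (Bottom, Top)"

text \<open>A midpoint inserted in the cell of \<open>e\<close> either splits \<open>e\<close>
  itself, or has a parent of level above \<open>l\<close> in the same cell. The recursion of
  \<open>cell_of\<close> follows the parent of higher level, so it stays in the cell until it
  reaches \<open>e\<close>.\<close>

lemma cell_of_subdiv_pow:
  assumes e: "e \<in> diamond_edges k l"
    and "(x, y) \<in> (subdiv k ^^ j) {e}" "w = x \<or> w = y" "l < dvertex_level w"
  shows "cell_of l w = e"
  using assms(2-)
proof (induction j arbitrary: x y w)
  case 0
  then show ?case using diamond_edges_level[of x y k l] e by auto
next
  case (Suc j)
  then have "(x, y) \<in> subdiv k ((subdiv k ^^ j) {e})" by simp
  then obtain a b i where ab: "(a, b) \<in> (subdiv k ^^ j) {e}"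
    and xy: "(x, y) = (a, Mid a b i) \<or> (x, y) = (Mid a b i, b)"
    by (rule subdivE)
  note IH = Suc.IH[OF ab]
  have "(a, b) \<in> diamond_edges k (l + j)"
    using ab e by (subst diamond_edges_cells[of l]) auto
  then have lev: "max (dvertex_level a) (dvertex_level b) = l + j"
    by (rule diamond_edges_level)
  have "cell_of l (Mid a b i) = e"
  proof (cases j)
    case 0
    with ab lev show ?thesis by simp
  next
    case (Suc j')
    with lev have *: "l < max (dvertex_level a) (dvertex_level b)" by simp
    show ?thesis using IH[of a] IH[of b] * by (auto simp: max_def split: if_splits)
  qed
  with IH[of a] IH[of b] xy Suc.prems show ?case by auto
qed

text \<open>Extending the indicator function of a vertex of the \<open>l\<close>-th diamond by averaging divides the
  variation along edges by two at each further step.\<close>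

fun potential :: "nat \<Rightarrow> dvertex \<Rightarrow> dvertex \<Rightarrow> real" where
  "potential l a (Mid u v i) =
    (if dvertex_level (Mid u v i) \<le> l then of_bool (Mid u v i = a)
     else (potential l a u + potential l a v) / 2)"
| "potential l a w = of_bool (w = a)"

lemma potential_low: "dvertex_level w \<le> l \<Longrightarrow> potential l a w = of_bool (w = a)"
  by (cases w) auto

lemma potential_edge:
  assumes "(x, y) \<in> diamond_edges k (l + j)"
  shows "\<bar>potential l a x - potential l a y\<bar> \<le> 1 / 2 ^ j"
  using assms
proof (induction j arbitrary: x y)
  case 0
  then show ?case using diamond_edges_level[of x y k l] by (auto simp: potential_low)
next
  case (Suc j)
  then obtain u v i where uv: "(u, v) \<in> diamond_edges k (l + j)"
    and xy: "(x, y) = (u, Mid u v i) \<or> (x, y) = (Mid u v i, v)"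
    by auto
  have "\<not> dvertex_level (Mid u v i) \<le> l" using diamond_edges_level[OF uv] by simp
  then have "potential l a (Mid u v i) = (potential l a u + potential l a v) / 2"
    unfolding potential.simps by (simp only: if_False)
  with xy have "\<bar>potential l a x - potential l a y\<bar> = \<bar>potential l a u - potential l a v\<bar> / 2"
    by (auto simp: abs_if field_simps)
  with Suc.IH[OF uv] show ?case by simp
qed

section \<open>Distances and walks in a fixed diamond\<close>

locale diamond_graph =
  fixes k m :: nat
  assumes k: "k \<ge> 1"
begin

sublocale connected_pair_graph "diamond k m"
  by (intro connected_pair_graph.intro connected_pair_graph_axioms.intro
    pair_graph_diamond connected_diamond k)

abbreviation "dd \<equiv> graph_dist (diamond k m)"

lemma verts_eq: "pverts (diamond k m) = diamond_verts k m"
  by (simp add: diamond_def)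

lemma arcs_iff:
  "(x, y) \<in> parcs (diamond k m) \<longleftrightarrow> (x, y) \<in> diamond_edges k m \<or> (y, x) \<in> diamond_edges k m"
  by (auto simp: diamond_def)

text \<open>The function \<open>potential l a\<close> is 1 at \<open>a\<close> and 0 at
  \<open>b\<close>, but changes by at most \<open>1 / 2 ^ (m - l)\<close> along each edge.\<close>

lemma dist_low_ge:
  assumes "l \<le> m" "a \<in> diamond_verts k l" "b \<in> diamond_verts k l" "a \<noteq> b"
  shows "2 ^ (m - l) \<le> dd a b"
proof -
  have "\<bar>potential l a x - potential l a y\<bar> \<le> 1 / 2 ^ (m - l)" if "(x, y) \<in> parcs (diamond k m)" for x y
    using that potential_edge[of x y k l "m - l" a] potential_edge[of y x k l "m - l" a] assms(1)
    by (auto simp: arcs_iff abs_minus_commute)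
  from lipschitz_graph_dist[of "potential l a", OF this, of a b]
  show ?thesis
    using assms diamond_verts_mono[OF assms(1), of k] diamond_verts_level[of _ k l]
    by (auto simp: verts_eq potential_low field_simps)
qed

lemma Field_cell_verts:
  assumes "e \<in> diamond_edges k l" "l \<le> m" "w \<in> Field ((subdiv k ^^ (m - l)) {e})"
  shows "w \<in> diamond_verts k m"
  using assms diamond_verts_cells[OF k assms(2)] by blast

lemma dist_corner_le:
  assumes "(u, v) \<in> diamond_edges k l" "l + j = m" "w \<in> Field ((subdiv k ^^ j) {(u, v)})"
  shows "dd w u \<le> 2 ^ j \<and> dd w v \<le> 2 ^ j"
  using assms
proof (induction j arbitrary: u v w l)
  case 0
  then show ?case
    using graph_dist_arc_le_1[of u v] graph_dist_arc_le_1[of v u] diamond_edges_verts[of u v k m]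
    by (auto simp: Field_def arcs_iff M.zero verts_eq)
next
  case (Suc j)
  \<comment> \<open>The first subdivision is split off, not the last: \<open>w\<close> then lies in
    a cell of height \<open>2 ^ j\<close> with the midpoint \<open>Mid u v i\<close> as a corner,
    and both \<open>u\<close> and \<open>v\<close> are reached through that midpoint.\<close>
  have "(subdiv k ^^ Suc j) {(u, v)} = (subdiv k ^^ j) (subdiv k {(u, v)})"
    by (simp add: funpow_swap1)
  then obtain e where e: "e \<in> subdiv k {(u, v)}" "w \<in> Field ((subdiv k ^^ j) {e})"
    using Suc.prems(3) Field_subdiv_pow[of j k "subdiv k {(u, v)}"] by auto
  then obtain i where i: "i < k" "e = (u, Mid u v i) \<or> e = (Mid u v i, v)"
    by (auto simp: subdiv_def)
  let ?c = "Mid u v i"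
  have E: "(u, ?c) \<in> diamond_edges k (Suc l)" "(?c, v) \<in> diamond_edges k (Suc l)"
    using i(1) Suc.prems(1) by auto
  have m: "Suc l + j = m" using Suc.prems(2) by simp
  have sub: "diamond_verts k (Suc l) \<subseteq> diamond_verts k m"
    by (rule diamond_verts_mono) (use m in simp)
  have V: "u \<in> diamond_verts k m" "v \<in> diamond_verts k m" "?c \<in> diamond_verts k m"
    using diamond_edges_verts[OF E(1)] diamond_edges_verts[OF E(2)]
    by (auto intro: subsetD[OF sub] simp del: diamond_verts.simps)
  have w: "w \<in> diamond_verts k m"
  proof (rule Field_cell_verts)
    show "e \<in> diamond_edges k (Suc l)" using i(2) E by blast
    show "w \<in> Field ((subdiv k ^^ (m - Suc l)) {e})" using e(2) m by auto
  qed (use m in simp)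
  have corner: "x \<in> Field ((subdiv k ^^ j') {(x, y)})" "y \<in> Field ((subdiv k ^^ j') {(x, y)})"
    for x y j'
    using Field_subset_subdiv_pow[OF k, of "{(x, y)}" j'] by (auto simp: Field_def)
  note IH1 = Suc.IH[OF E(1) m] and IH2 = Suc.IH[OF E(2) m]
  have uc: "dd ?c u \<le> 2 ^ j" "dd ?c v \<le> 2 ^ j"
    using IH1[OF corner(2)] IH2[OF corner(1)] by auto
  have "dd w u \<le> dd w ?c + dd ?c u" "dd w v \<le> dd w ?c + dd ?c v"
    using M.triangle V w by (simp_all add: verts_eq)
  moreover have "dd w ?c \<le> 2 ^ j"
    using IH1[of w] IH2[of w] e(2) i(2) by auto
  ultimately show ?case using uc by simp
qed

text \<open>An edge whose endpoints both avoid the \<open>l\<close>-th diamond lies in a single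
  cell, so a walk can change cells only through a vertex of that diamond. The induction keeps the
  initial piece of the walk up to such a vertex.\<close>

lemma cell_of_walk:
  assumes "l \<le> m" "awalk x p y" "x \<notin> diamond_verts k l"
  shows "(cell_of l x = cell_of l y \<and> y \<notin> diamond_verts k l) \<or>
    (\<exists>a\<in>diamond_verts k l. dd x a \<le> real (length p))"
proof -
  have "(cell_of l x = cell_of l y \<and> y \<notin> diamond_verts k l) \<or>
    (\<exists>a\<in>diamond_verts k l. \<exists>q. awalk x q a \<and> length q \<le> length p)"
    using assms(2,3)
  proof (induction p arbitrary: x)
    case (Cons e p)
    then obtain z where z: "e = (x, z)" "(x, z) \<in> parcs (diamond k m)" "awalk z p y"
      by (cases e) (auto simp: awalk_Cons_iff)
    have xz: "awalk x [(x, z)] z"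
      using z(2) arc_fst_in_verts arc_snd_in_verts by (force simp: awalk_Cons_iff awalk_Nil_iff)
    show ?case
    proof (cases "z \<in> diamond_verts k l")
      case True
      with xz show ?thesis by (intro disjI2 bexI[of _ z] exI[of _ "[(x, z)]"]) auto
    next
      case False
      have lev: "l < dvertex_level x" "l < dvertex_level z"
        using diamond_verts_low_level[of _ k m l] assms(1) False Cons.prems(2) z(2)
          diamond_edges_verts[of _ _ k m] by (force simp: arcs_iff not_le[symmetric])+
      obtain e x' z' where e: "e \<in> diamond_edges k l" "(x', z') \<in> (subdiv k ^^ (m - l)) {e}"
        "{x, z} = {x', z'}"
        using z(2) diamond_edges_cells[OF assms(1), of k] by (fastforce simp: arcs_iff)
      then have "cell_of l x = e" "cell_of l z = e"
        using cell_of_subdiv_pow[OF e(1,2)] lev by blast+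
      moreover have "\<exists>q. awalk x q a \<and> length q \<le> length (e' # p)"
        if "awalk z q a" "length q \<le> length p" for q a e'
        using awalk_appendI[OF xz that(1)] that(2) by (intro exI[of _ "(x, z) # q"]) auto
      ultimately show ?thesis
        using Cons.IH[OF z(3) False] by metis
    qed
  qed (auto simp: awalk_Nil_iff)
  then show ?thesis using graph_dist_le_length by (meson of_nat_le_iff order_trans)
qed

text \<open>A geodesic from \<open>x\<close> to \<open>y\<close> is too short to reach a vertex of
  the \<open>l\<close>-th diamond.\<close>

lemma cell_of_eq:
  assumes "l \<le> m" "x \<in> diamond_verts k m" "y \<in> diamond_verts k m"
    and far: "\<And>a. a \<in> diamond_verts k l \<Longrightarrow> dd x y < dd x a"
  shows "cell_of l x = cell_of l y"
proof -
  obtain p where p: "awalk x p y" "dd x y = real (length p)"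
    using obtain_geodesic assms(2,3) by (metis verts_eq)
  have "x \<notin> diamond_verts k l"
    using far[of x] assms(2) M.nonneg[of x y] by (auto simp: M.zero verts_eq not_less)
  from cell_of_walk[OF assms(1) p(1) this] far p(2) show ?thesis by fastforce
qed

lemma Field_cell_of:
  assumes "l \<le> m" "w \<in> diamond_verts k m" "w \<notin> diamond_verts k l"
  shows "cell_of l w \<in> diamond_edges k l \<and> w \<in> Field ((subdiv k ^^ (m - l)) {cell_of l w})"
proof -
  have lev: "l < dvertex_level w"
    using assms diamond_verts_low_level[of w k m l] by force
  obtain e where e: "e \<in> diamond_edges k l" "w \<in> Field ((subdiv k ^^ (m - l)) {e})"
    using assms(2) diamond_verts_cells[OF k assms(1)] by blast
  then obtain x y where "(x, y) \<in> (subdiv k ^^ (m - l)) {e}" "w = x \<or> w = y"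
    by (auto simp: Field_def)
  from cell_of_subdiv_pow[OF e(1) this lev] e show ?thesis by simp
qed

text \<open>A separated set meets each subcell of height \<open>2 ^ i\<close> in at most two points; for \<open>i = 0\<close>
  the subcells are single edges, and both endpoints may occur.\<close>

lemma card_separated_le:
  assumes l: "l + j = m" "e \<in> diamond_edges k l" "i \<le> j"
    and W: "W \<subseteq> Field ((subdiv k ^^ j) {e})"
    and r: "i = 0 \<or> 2 * 2 ^ i < r"
    and sep: "\<And>x y. x \<in> W \<Longrightarrow> y \<in> W \<Longrightarrow> x \<noteq> y \<Longrightarrow> r \<le> dd x y"
  shows "card W \<le> 2 * (2 * k) ^ (j - i)"
proof -
  let ?F = "(subdiv k ^^ (j - i)) {e}"
  have "(subdiv k ^^ j) {e} = (subdiv k ^^ i) ?F"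
    using l(3) funpow_add[of i "j - i" "subdiv k"] by simp
  then have "W \<subseteq> (\<Union>e'\<in>?F. Field ((subdiv k ^^ i) {e'}))"
    using W Field_subdiv_pow[of i k ?F] by simp
  then have "\<forall>w\<in>W. \<exists>e'\<in>?F. w \<in> Field ((subdiv k ^^ i) {e'})"
    by blast
  then obtain c where c: "\<And>w. w \<in> W \<Longrightarrow> c w \<in> ?F"
    "\<And>w. w \<in> W \<Longrightarrow> w \<in> Field ((subdiv k ^^ i) {c w})"
    by metis
  have E: "?F \<subseteq> diamond_edges k (l + (j - i))"
    using diamond_edges_cells[of l "l + (j - i)" k] l(2) by auto
  \<comment> \<open>The boolean tells apart the two endpoints of a single edge when
    \<open>i = 0\<close>. For larger \<open>i\<close> the subcell alone determines the point:
    through a corner, two of its points are at distance at most \<open>2 * 2 ^ i\<close>, which is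
    below \<open>r\<close>.\<close>
  have "inj_on (\<lambda>w. (c w, w = snd (c w))) W"
  proof (rule inj_onI)
    fix x y assume xy: "x \<in> W" "y \<in> W" and eq: "(c x, x = snd (c x)) = (c y, y = snd (c y))"
    obtain u v where uv: "c x = (u, v)" by force
    have uvE: "(u, v) \<in> diamond_edges k (l + (j - i))" using c(1)[OF xy(1)] uv E by auto
    show "x = y"
    proof (cases "i = 0")
      case True
      have "c y = (u, v)" using eq uv by simp
      with c(2)[OF xy(1)] c(2)[OF xy(2)] eq uv True show ?thesis
        by (auto simp: Field_def)
    next
      case False
      have m: "l + (j - i) + i = m" using l by simp
      have cells: "x \<in> Field ((subdiv k ^^ i) {(u, v)})" "y \<in> Field ((subdiv k ^^ i) {(u, v)})"
        using c(2)[OF xy(1)] c(2)[OF xy(2)] eq uv by auto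
      have "x \<in> diamond_verts k m" "y \<in> diamond_verts k m" "u \<in> diamond_verts k m"
        using Field_cell_verts[OF uvE] cells m diamond_edges_verts[OF uvE]
          diamond_verts_mono[of "l + (j - i)" m k] by auto
      then have "dd x y \<le> dd x u + dd y u"
        using M.triangle[of x u y] M.commute[of u y] by (simp add: verts_eq)
      also have "\<dots> \<le> 2 * 2 ^ i"
        using dist_corner_le[OF uvE m cells(1)] dist_corner_le[OF uvE m cells(2)] by simp
      finally show ?thesis using r False sep[OF xy] by fastforce
    qed
  qed
  moreover have "(\<lambda>w. (c w, w = snd (c w))) ` W \<subseteq> ?F \<times> UNIV" using c(1) by auto
  ultimately have "card W \<le> card (?F \<times> (UNIV :: bool set))"
    by (rule card_inj_on_le) (simp add: finite_subdiv_pow)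
  also have "\<dots> \<le> 2 * (2 * k) ^ (j - i)"
    using card_subdiv_pow[of "j - i" k e] by (simp add: card_cartesian_product)
  finally show ?thesis .
qed

end

section \<open>Binary trees in diamonds\<close>

lemma finite_Bottom_neighbours: "finite {v. (Bottom, v) \<in> diamond_edges k m}"
  by (rule finite_subset[OF _ finite_diamond_verts[of k m]]) (auto dest: diamond_edges_verts)

text \<open>Each edge at \<open>Bottom\<close> is replaced by \<open>k\<close> paths, hence by at
  least two new edges at \<open>Bottom\<close>.\<close>

lemma card_Bottom_neighbours:
  assumes "k \<ge> 2"
  shows "2 ^ m \<le> card {v. (Bottom, v) \<in> diamond_edges k m}"
proof (induction m)
  case (Suc m)
  let ?A = "\<lambda>m. {v. (Bottom, v) \<in> diamond_edges k m}"
  have "2 ^ Suc m \<le> card (?A m) * k"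
    using mult_le_mono[OF Suc assms] by simp
  also have "\<dots> = card ((\<lambda>(v, i). Mid Bottom v i) ` (?A m \<times> {..<k}))"
    by (subst card_image) (auto simp: inj_on_def card_cartesian_product)
  also have "\<dots> \<le> card (?A (Suc m))"
    by (intro card_mono finite_Bottom_neighbours) fastforce
  finally show ?case .
qed simp

text \<open>After the first step every edge joins a new midpoint to an older vertex; the initial
  edge joins two vertices of level 0. Consequently neighbours of \<open>Bottom\<close>, which all
  have level \<open>m\<close>, are not adjacent to each other.\<close>

lemma diamond_edges_level_neq:
  assumes "(x, y) \<in> diamond_edges k m" "m \<ge> 1"
  shows "dvertex_level x \<noteq> dvertex_level y"
proof -
  obtain m' where m: "m = Suc m'" using assms(2) by (cases m) auto
  then have "(x, y) \<in> subdiv k (diamond_edges k m')"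
    using assms(1) by (simp only: diamond_edges_Suc)
  then obtain a b i where ab: "(a, b) \<in> diamond_edges k m'"
    and xy: "(x, y) = (a, Mid a b i) \<or> (x, y) = (Mid a b i, b)"
    by (rule subdivE)
  from xy show ?thesis by (auto simp: max_def split: if_splits)
qed

lemma (in diamond_graph) dist_Bottom_neighbours:
  assumes "m \<ge> 1" "(Bottom, x) \<in> diamond_edges k m" "(Bottom, y) \<in> diamond_edges k m" "x \<noteq> y"
  shows "dd x y = 2"
proof (rule antisym)
  have V: "x \<in> pverts (diamond k m)" "y \<in> pverts (diamond k m)" "Bottom \<in> pverts (diamond k m)"
    using assms diamond_edges_verts by (auto simp: verts_eq)
  have "dd x Bottom \<le> 1" "dd Bottom y \<le> 1"
    using assms by (auto intro!: graph_dist_arc_le_1 simp: arcs_iff)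
  then show "dd x y \<le> 2" using M.triangle[OF V(1,3,2)] by simp
  have "dvertex_level x = dvertex_level y"
    using diamond_edges_level[OF assms(2)] diamond_edges_level[OF assms(3)] by simp
  then have "(x, y) \<notin> parcs (diamond k m)"
    using diamond_edges_level_neq[OF _ assms(1)] by (fastforce simp: arcs_iff)
  then show "2 \<le> dd x y" using graph_dist_ge_2 V assms(4) by blast
qed

lemma diamond_distortion_binary_tree:
  assumes "k \<ge> 1"
  shows "diamond_distortion k (graph_metric (binary_tree n)) = Inf {ereal C | C. 1 \<le> C \<and>
    (\<exists>m\<ge>1. \<exists>f r. f ` {s. length s \<le> n} \<subseteq> diamond_verts k m \<and> 0 < r \<and>
      (\<forall>u v. length u \<le> n \<longrightarrow> length v \<le> n \<longrightarrow>
        r * graph_dist (binary_tree n) u v \<le> graph_dist (diamond k m) (f u) (f v) \<and>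
        graph_dist (diamond k m) (f u) (f v) \<le> r * C * graph_dist (binary_tree n) u v))}"
proof -
  have "mspace (graph_metric (binary_tree n)) = {s. length s \<le> n}"
    "mspace (graph_metric (diamond k m)) = diamond_verts k m"
    "mdist (graph_metric (binary_tree n)) = graph_dist (binary_tree n)"
    "mdist (graph_metric (diamond k m)) = graph_dist (diamond k m)" for m
    using pair_graph_binary_tree[of n] connected_binary_tree[of n]
      pair_graph_diamond[of k m] connected_diamond[OF assms, of m]
    by (simp_all only: mspace_graph_metric mdist_graph_metric)
      (simp_all add: binary_tree_def diamond_def)
  then show ?thesis
    unfolding diamond_distortion_def distortion_def by (simp add: Ball_def)
qed

lemma diamond_distortion_binary_tree_le:
  assumes "k \<ge> 2" "n \<ge> 1"
  shows "diamond_distortion k (graph_metric (binary_tree n)) \<le> ereal (2 * real n)"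
proof -
  interpret T: binary_tree_graph n .
  let ?L = "{s :: bool list. length s \<le> n}"
  \<comment> \<open>The star around \<open>Bottom\<close> has at least \<open>2 ^ m\<close> leaves,
    which exceeds \<open>m\<close>, so there is room for all vertices of the tree.\<close>
  define m where "m = card ?L"
  interpret D: diamond_graph k m by unfold_locales (use assms in simp)
  let ?A = "{v. (Bottom, v) \<in> diamond_edges k m}"
  have fin: "finite ?L" using finite_lists_length_le[of "UNIV :: bool set" n] by simp
  moreover have "[] \<in> ?L" by simp
  ultimately have m: "m \<ge> 1" unfolding m_def by (metis One_nat_def Suc_leI card_gt_0_iff empty_iff)
  have "card ?L \<le> card ?A"
    using card_Bottom_neighbours[OF assms(1), of m] less_exp[of m] by (fold m_def) linarith
  then obtain f where f: "f ` ?L \<subseteq> ?A" "inj_on f ?L"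
    using card_le_inj[OF fin finite_Bottom_neighbours] by blast
  have "f ` ?L \<subseteq> pverts (diamond k m)"
    using f(1) diamond_edges_verts by (force simp: D.verts_eq)
  \<comment> \<open>Distinct tree vertices have distance between 1 and \<open>2 * n\<close>, and
    their images have distance 2; the scale \<open>1 / n\<close> makes the lower estimate sharp at
    distance \<open>2 * n\<close>.\<close>
  moreover have "1 / real n * graph_dist (binary_tree n) u v \<le> D.dd (f u) (f v) \<and>
      D.dd (f u) (f v) \<le> 1 / real n * (2 * real n) * graph_dist (binary_tree n) u v"
    if uv: "u \<in> ?L" "v \<in> ?L" for u v
  proof (cases "u = v")
    case True
    have "f v \<in> pverts (diamond k m)" using f(1) uv diamond_edges_verts by (force simp: D.verts_eq)
    then have "D.dd (f v) (f v) = 0" using D.M.zero by blast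
    moreover have "graph_dist (binary_tree n) v v = 0" using T.M.zero uv by auto
    ultimately show ?thesis using True by simp
  next
    case False
    have "f u \<noteq> f v" using False f(2) uv by (meson inj_onD)
    then have "D.dd (f u) (f v) = 2" using D.dist_Bottom_neighbours[OF m] f(1) uv by blast
    moreover have "1 \<le> graph_dist (binary_tree n) u v" "graph_dist (binary_tree n) u v \<le> 2 * real n"
      using T.graph_dist_ge_1[of u v] T.dist_le[of u v] False uv by auto
    ultimately show ?thesis using assms(2) by (simp add: field_simps)
  qed
  ultimately show ?thesis
    unfolding diamond_distortion_binary_tree[OF D.k]
    using assms m
    by (intro Inf_lower CollectI exI[of _ "2 * real n"] conjI exI[of _ m] exI[of _ f] exI[of _ "1 / real n"])
      (auto simp: D.verts_eq)
qed

section \<open>Lower bound: confining a subtree to a cell and counting its leaves\<close>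

lemma (in diamond_graph) subtree_in_cell:
  fixes r C :: real
  assumes r: "0 < r" and C: "1 \<le> C" and q: "C < real q" "q \<le> n"
    and f: "\<And>s. length s \<le> n \<Longrightarrow> f s \<in> diamond_verts k m"
    and lower: "\<And>s t. length s \<le> n \<Longrightarrow> length t \<le> n \<Longrightarrow> r * graph_dist (binary_tree n) s t \<le> dd (f s) (f t)"
    and upper: "\<And>s t. length s \<le> n \<Longrightarrow> length t \<le> n \<Longrightarrow> dd (f s) (f t) \<le> r * C * graph_dist (binary_tree n) s t"
    and j: "j \<le> m" "2 * (r * C) * (real n + 1) < 2 ^ j"
  obtains b e where "e \<in> diamond_edges k (m - j)"
    "\<And>s. length s \<le> n - q \<Longrightarrow> f (replicate q b @ s) \<in> Field ((subdiv k ^^ j) {e})"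
proof -
  interpret T: binary_tree_graph n .
  define l where "l = m - j"
  have l: "l \<le> m" "m - l = j" using j(1) by (auto simp: l_def)
  let ?V = "diamond_verts k l"
  define near where "near s \<longleftrightarrow> (\<exists>a\<in>?V. dd (f s) a \<le> r * C)" for s
  have q0: "q > 0" using q C by simp
  have rC: "0 < r * C" using r C by simp
  have V: "a \<in> pverts (diamond k m)" if "a \<in> ?V" for a
    using that diamond_verts_mono[OF l(1)] by (auto simp: verts_eq)
  have fV: "f s \<in> pverts (diamond k m)" if "length s \<le> n" for s
    using f that by (simp add: verts_eq)
  have rad: "dd (f []) (f s) \<le> r * C * real n" if "length s \<le> n" for s
  proof -
    have "dd (f []) (f s) \<le> r * C * graph_dist (binary_tree n) [] s" using upper that by simp
    also have "\<dots> \<le> r * C * real n"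
      using T.dist_root_le[OF that] that rC by (intro mult_left_mono) auto
    finally show ?thesis .
  qed
  \<comment> \<open>The two nearby vertices \<open>a\<close> and \<open>a'\<close> are less than
    \<open>2 ^ j\<close> apart: the path between them consists of two excursions of length
    \<open>r * C\<close> and two radii \<open>r * C * n\<close> around the image of the root. Hence
    they coincide, and dividing by the scale \<open>r\<close> bounds the tree distance.\<close>
  have near_close: "graph_dist (binary_tree n) s t \<le> 2 * C"
    if near: "near s" "near t" and s: "length s \<le> n" and t: "length t \<le> n" for s t
  proof -
    obtain a a' where a: "a \<in> ?V" "dd (f s) a \<le> r * C" and a': "a' \<in> ?V" "dd (f t) a' \<le> r * C"
      using near unfolding near_def by blast
    have "dd a a' \<le> dd a (f s) + dd (f s) (f []) + dd (f []) (f t) + dd (f t) a'"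
      using M.triangle[of a "f s" a'] M.triangle[of "f s" "f []" a'] M.triangle[of "f []" "f t" a']
        V a(1) a'(1) fV s t by fastforce
    also have "\<dots> \<le> 2 * (r * C) * (real n + 1)"
      using a(2) a'(2) rad[OF s] rad[OF t] M.commute[of a "f s"] M.commute[of "f s" "f []"]
      by (simp add: algebra_simps)
    also have "\<dots> < 2 ^ (m - l)" using j l by simp
    finally have "a = a'" using dist_low_ge[OF l(1) a(1) a'(1)] by fastforce
    then have "dd (f s) (f t) \<le> 2 * (r * C)"
      using M.triangle[of "f s" a "f t"] a a' fV s t V M.commute[of a "f t"] by simp
    with lower[OF s t] have "r * graph_dist (binary_tree n) s t \<le> r * (2 * C)" by simp
    then show ?thesis using r by simp
  qed
  \<comment> \<open>Vertices of the two subtrees lie at depth at least \<open>q\<close> in opposite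
    halves of the tree, so their distance is at least \<open>2 * q\<close>, more than
    \<open>near_close\<close> permits.\<close>
  obtain b where b: "\<And>s. length s \<le> n - q \<Longrightarrow> \<not> near (replicate q b @ s)"
  proof (rule ccontr)
    assume contra: "\<not> thesis"
    have "\<exists>s. length s \<le> n - q \<and> near (replicate q b @ s)" for b
      using contra that[of b] by blast
    then obtain s t where s: "length s \<le> n - q" "near (replicate q True @ s)"
      and t: "length t \<le> n - q" "near (replicate q False @ t)"
      by metis
    let ?s = "replicate q True @ s" and ?t = "replicate q False @ t"
    have len: "length ?s \<le> n" "length ?t \<le> n" using s t q(2) by auto
    have "real (length ?s) + real (length ?t) \<le> graph_dist (binary_tree n) ?s ?t"
      using len q0 by (intro T.dist_opposite_ge) (auto simp: hd_append)
    also have "\<dots> \<le> 2 * C" by (rule near_close[OF s(2) t(2) len])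
    finally show False using q(1) by simp
  qed
  let ?g = "\<lambda>s. f (replicate q b @ s)"
  have far: "r * C < dd (?g s) a" if "length s \<le> n - q" "a \<in> ?V" for s a
    using b[OF that(1)] that(2) by (auto simp: near_def not_le)
  have outside: "?g s \<notin> ?V" if "length s \<le> n - q" for s
  proof
    assume V: "?g s \<in> ?V"
    have "dd (?g s) (?g s) = 0" using fV[of "replicate q b @ s"] that q(2) M.zero by force
    with far[OF that V] rC show False by simp
  qed
  \<comment> \<open>Walking down from the root of the subtree, each tree edge moves the image by at
    most \<open>r * C\<close>, which is less than its distance to every vertex of
    \<open>?V\<close>.\<close>
  have cell: "cell_of l (?g s) = cell_of l (?g [])" if "length s \<le> n - q" for s
    using that
  proof (induction s rule: rev_induct)
    case (snoc c s)
    let ?s = "replicate q b @ s"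
    have len: "length ?s < n" using snoc.prems q(2) by simp
    have "dd (f ?s) (f (?s @ [c])) \<le> r * C * graph_dist (binary_tree n) ?s (?s @ [c])"
      using len by (intro upper) auto
    also have "\<dots> \<le> r * C * 1"
      using T.graph_dist_arc_le_1[OF T.child_arc[OF len]] rC by (intro mult_left_mono) auto
    finally have step: "dd (?g s) (?g (s @ [c])) \<le> r * C" by simp
    have "cell_of l (?g s) = cell_of l (?g (s @ [c]))"
    proof (rule cell_of_eq[OF l(1)])
      show "?g s \<in> diamond_verts k m" "?g (s @ [c]) \<in> diamond_verts k m"
        using f len by auto
      show "dd (?g s) (?g (s @ [c])) < dd (?g s) a" if "a \<in> ?V" for a
        using far[of s a] that step snoc.prems by simp
    qed
    with snoc show ?case by simp
  qed simp
  show thesis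
  proof (rule that)
    show "cell_of l (?g []) \<in> diamond_edges k (m - j)"
      using Field_cell_of[OF l(1) f outside, of "[]"] q(2) by (simp add: l_def)
    show "?g s \<in> Field ((subdiv k ^^ j) {cell_of l (?g [])})" if "length s \<le> n - q" for s
    proof -
      have "?g s \<in> diamond_verts k m" using that q(2) by (intro f) simp
      from Field_cell_of[OF l(1) this outside[OF that]] show ?thesis
        using cell[OF that] l by simp
    qed
  qed
qed

text \<open>The cell containing the subtree has height comparable with the diameter of the image, and the
  resolution at which its points are counted is comparable with \<open>r\<close>.\<close>

lemma (in diamond_graph) embedding_bound:
  fixes r C :: real
  assumes r: "0 < r" and C: "1 \<le> C" and q: "C < real q" "q \<le> n"
    and f: "\<And>s. length s \<le> n \<Longrightarrow> f s \<in> diamond_verts k m"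
    and lower: "\<And>s t. length s \<le> n \<Longrightarrow> length t \<le> n \<Longrightarrow> r * graph_dist (binary_tree n) s t \<le> dd (f s) (f t)"
    and upper: "\<And>s t. length s \<le> n \<Longrightarrow> length t \<le> n \<Longrightarrow> dd (f s) (f t) \<le> r * C * graph_dist (binary_tree n) s t"
  obtains t where "2 ^ t \<le> 16 * C * (real n + 1)" "2 ^ (n - q) \<le> 2 * (2 * k) ^ t"
proof -
  interpret T: binary_tree_graph n .
  \<comment> \<open>The alternative \<open>j = m\<close> guarantees that a least \<open>j\<close>
    exists. If it is the only option, the whole diamond serves as the cell.\<close>
  define P where "P j \<longleftrightarrow> j = m \<or> 2 * (r * C) * (real n + 1) < 2 ^ j" for j
  define j where "j = (LEAST j. P j)"
  have "P m" by (simp add: P_def)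
  then have j: "P j" "j \<le> m" unfolding j_def by (auto intro: LeastI Least_le)
  obtain b e where e: "e \<in> diamond_edges k (m - j)"
    "\<And>s. length s \<le> n - q \<Longrightarrow> f (replicate q b @ s) \<in> Field ((subdiv k ^^ j) {e})"
  proof (cases "j = m")
    case True
    have "f s \<in> Field ((subdiv k ^^ j) {(Bottom, Top)})" if "length s \<le> n" for s
      using f[OF that] diamond_verts_cells[OF k, of 0 m] True by simp
    then show thesis using q(2) True by (intro that[of "(Bottom, Top)" True]) auto
  next
    case False
    then have "2 * (r * C) * (real n + 1) < 2 ^ j" using j by (simp add: P_def)
    from subtree_in_cell[OF r C q f lower upper j(2) this] that show thesis by metis
  qed
  define I where "I = {i. i \<le> j \<and> (i = 0 \<or> 2 * 2 ^ i < r)}"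
  define i where "i = Max I"
  have I: "finite I" "0 \<in> I" by (auto simp: I_def)
  then have "i \<in> I" unfolding i_def by (intro Max_in) auto
  then have i: "i \<le> j" "i = 0 \<or> 2 * 2 ^ i < r" by (auto simp: I_def)
  define W where "W = f ` (\<lambda>s. replicate q b @ s) ` {s. length s = n - q}"
  have sep1: "r \<le> dd (f s) (f t)" if "length s \<le> n" "length t \<le> n" "s \<noteq> t" for s t
  proof -
    have "r * 1 \<le> r * graph_dist (binary_tree n) s t"
      using T.graph_dist_ge_1[of s t] that r by (intro mult_left_mono) auto
    also have "\<dots> \<le> dd (f s) (f t)" by (rule lower[OF that(1,2)])
    finally show ?thesis by simp
  qed
  have inj: "inj_on f {s. length s \<le> n}"
  proof (rule inj_onI, rule ccontr)
    fix s t assume st: "s \<in> {s. length s \<le> n}" "t \<in> {s. length s \<le> n}" "f s = f t" "s \<noteq> t"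
    then have "dd (f s) (f t) = 0" using f[of t] M.zero[of "f t" "f t"] by (simp add: verts_eq)
    with sep1[of s t] st r show False by simp
  qed
  have sub: "(\<lambda>s. replicate q b @ s) ` {s. length s = n - q} \<subseteq> {s. length s \<le> n}"
    using q(2) by auto
  have "card W = card ((\<lambda>s. replicate q b @ s) ` {s. length s = n - q})"
    unfolding W_def by (rule card_image[OF inj_on_subset[OF inj sub]])
  also have "\<dots> = card {s :: bool list. length s = n - q}"
    by (rule card_image) (simp add: inj_on_def)
  also have "\<dots> = 2 ^ (n - q)"
    using card_lists_length_eq[of "UNIV :: bool set" "n - q"] by simp
  finally have "2 ^ (n - q) = card W" by simp
  also have "\<dots> \<le> 2 * (2 * k) ^ (j - i)"
  proof (rule card_separated_le[OF _ e(1) i(1) _ i(2)])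
    show "m - j + j = m" using j(2) by simp
    show "W \<subseteq> Field ((subdiv k ^^ j) {e})" using e(2) by (auto simp: W_def)
    show "r \<le> dd x y" if xy: "x \<in> W" "y \<in> W" "x \<noteq> y" for x y
    proof -
      obtain s t where "x = f s" "y = f t" "length s \<le> n" "length t \<le> n"
        using xy(1,2) sub unfolding W_def by blast
      with sep1[of s t] xy(3) show ?thesis by auto
    qed
  qed
  finally have count: "2 ^ (n - q) \<le> 2 * (2 * k) ^ (j - i)" .
  have "2 ^ (j - i) \<le> 16 * C * (real n + 1)"
  proof (cases "i = j")
    case True
    have "1 * 1 \<le> 16 * C * (real n + 1)" using C by (intro mult_mono) auto
    with True show ?thesis by simp
  next
    case False
    with i have ij: "i < j" by simp
    \<comment> \<open>Maximality of \<open>i\<close> bounds \<open>r\<close> by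
      \<open>4 * 2 ^ i\<close>, and minimality of \<open>j\<close> bounds \<open>2 ^ (j - 1)\<close>
      by a multiple of \<open>r\<close>. Eliminating \<open>r\<close> leaves a bound on
      \<open>2 ^ (j - i)\<close> that does not depend on the scale.\<close>
    have "Suc i \<notin> I" using Max_ge[OF I(1), of "Suc i"] by (auto simp: i_def)
    then have r4: "r \<le> 4 * 2 ^ i" using ij by (simp add: I_def)
    have "\<not> P (j - 1)" using not_less_Least[of "j - 1" P] ij by (simp add: j_def)
    then have "2 ^ (j - 1) \<le> 2 * (r * C) * (real n + 1)" by (simp add: P_def)
    then have "2 * 2 ^ (j - 1) \<le> r * (4 * C * (real n + 1))" by (simp add: algebra_simps)
    also have "\<dots> \<le> 4 * 2 ^ i * (4 * C * (real n + 1))"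
      using r4 C by (intro mult_right_mono) auto
    also have "2 * 2 ^ (j - 1) = (2::real) ^ j" using ij by (cases j) auto
    finally have "2 ^ i * 2 ^ (j - i) \<le> 2 ^ i * (16 * C * (real n + 1))"
      using ij by (simp flip: power_add)
    then show ?thesis by simp
  qed
  from that[OF this count] show thesis .
qed

lemma distortion_ge_linear:
  assumes "k \<ge> 1"
  obtains N where "\<And>n. n \<ge> N \<Longrightarrow>
    ereal (real n / 4) \<le> diamond_distortion k (graph_metric (binary_tree n))"
proof -
  \<comment> \<open>The two sides compare the point count with the leaf count when
    \<open>C < n / 4\<close>: then \<open>2 ^ t\<close> is at most \<open>8 * n ^ 2\<close>, and
    \<open>2 * k\<close> is at most \<open>2 ^ (k + 1)\<close>, so \<open>(2 * k) ^ t\<close> is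
    polynomial in \<open>n\<close>, while \<open>n - q\<close> is at least
    \<open>3 * n / 4 - 1\<close>.\<close>
  have "\<forall>\<^sub>F n in sequentially. 2 * (8 * real n ^ 2) ^ (k + 1) < 2 powr (3 * real n / 4 - 1)"
    by real_asymp
  then obtain N where N: "\<And>n. n \<ge> N \<Longrightarrow> 2 * (8 * real n ^ 2) ^ (k + 1) < 2 powr (3 * real n / 4 - 1)"
    by (auto simp: eventually_sequentially)
  show thesis
  proof (rule that[of "max N 2"])
    fix n assume n: "n \<ge> max N 2"
    show "ereal (real n / 4) \<le> diamond_distortion k (graph_metric (binary_tree n))"
      unfolding diamond_distortion_binary_tree[OF assms]
    proof (rule Inf_greatest, clarify)
      fix C m f r
      assume C: "1 \<le> C" and r: "0 < (r::real)"
        and f: "f ` {s. length s \<le> n} \<subseteq> diamond_verts k m"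
        and dist: "\<forall>u v. length u \<le> n \<longrightarrow> length v \<le> n \<longrightarrow>
          r * graph_dist (binary_tree n) u v \<le> graph_dist (diamond k m) (f u) (f v) \<and>
          graph_dist (diamond k m) (f u) (f v) \<le> r * C * graph_dist (binary_tree n) u v"
      interpret D: diamond_graph k m by unfold_locales (rule assms)
      show "ereal (real n / 4) \<le> ereal C"
      proof (rule ccontr)
        assume "\<not> ereal (real n / 4) \<le> ereal C"
        then have Cn: "C < real n / 4" by simp
        \<comment> \<open>The least integer above \<open>C\<close>, so that the subtree loses as
          little depth as possible.\<close>
        define q where "q = nat \<lfloor>C\<rfloor> + 1"
        have q: "C < real q" "real q \<le> real n / 4 + 1"
          unfolding q_def using C Cn by linarith+
        then have qn: "q \<le> n" using C Cn by linarith
        obtain t where t: "2 ^ t \<le> 16 * C * (real n + 1)" "2 ^ (n - q) \<le> 2 * (2 * k) ^ t"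
          using D.embedding_bound[OF r C q(1) qn, of f] f dist by blast
        have "2 powr (3 * real n / 4 - 1) \<le> 2 powr real (n - q)"
          using q(2) qn by (intro powr_mono) (auto simp: of_nat_diff)
        also have "\<dots> = real (2 ^ (n - q))" by (simp add: powr_realpow)
        also have "\<dots> \<le> real (2 * (2 * k) ^ t)" using t(2) by (rule of_nat_mono)
        also have "\<dots> \<le> 2 * (2 ^ (k + 1)) ^ t"
        proof -
          have "2 * k \<le> 2 ^ (k + 1)" using less_exp[of k] by simp
          then have "(2 * k) ^ t \<le> (2 ^ (k + 1)) ^ t" by (rule power_mono) simp
          then have "2 * (2 * k) ^ t \<le> 2 * (2 ^ (k + 1)) ^ t" by simp
          from of_nat_mono[OF this, where 'a = real] show ?thesis by simp
        qed
        also have "\<dots> = 2 * (2 ^ t) ^ (k + 1)" by (simp only: power_mult[symmetric] mult.commute)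
        also have "\<dots> \<le> 2 * (8 * real n ^ 2) ^ (k + 1)"
        proof -
          have "16 * C * (real n + 1) \<le> 16 * (real n / 4) * (real n + 1)"
            using Cn C by (intro mult_right_mono) auto
          also have "\<dots> = 4 * real n ^ 2 + 4 * real n" by (simp add: power2_eq_square algebra_simps)
          also have "\<dots> \<le> 8 * real n ^ 2" using n by (simp add: power2_eq_square)
          finally show ?thesis using t(1) by (intro mult_left_mono power_mono) auto
        qed
        also have "\<dots> < 2 powr (3 * real n / 4 - 1)" using N n by simp
        finally show False by simp
      qed
    qed
  qed
qed

lemma distortion_ge_1: "1 \<le> distortion M R"
  unfolding distortion_def by (rule Inf_greatest) auto

theorem theorem2p6:
  fixes k :: nat
  assumes "k \<ge> 2"
  shows "\<exists>c::real. c > 0 \<and> (\<forall>n::nat. n \<ge> 2 \<longrightarrow>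
    ereal (c * (real n / log 2 (real n))) \<le> diamond_distortion k (graph_metric (binary_tree n)) \<and>
    diamond_distortion k (graph_metric (binary_tree n)) \<le> ereal (2 * real n))"
proof -
  have "k \<ge> 1" using assms by simp
  from distortion_ge_linear[OF this] obtain N where N: "\<And>n. n \<ge> N \<Longrightarrow>
      ereal (real n / 4) \<le> diamond_distortion k (graph_metric (binary_tree n))"
    by blast
  \<comment> \<open>The factor \<open>1 / 4\<close> serves the range of the linear bound, since the
    logarithm is at least 1. For \<open>n < N\<close> the other term gives \<open>c * n\<close> at
    most 1, and every distortion is at least 1.\<close>
  define c where "c = min (1 / 4) (1 / (real N + 1))"
  have c: "0 < c" by (simp add: c_def)
  have "ereal (c * (real n / log 2 (real n))) \<le> diamond_distortion k (graph_metric (binary_tree n))"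
    if n: "n \<ge> 2" for n
  proof -
    have "1 \<le> log 2 (real n)" using n by (simp add: le_log_iff)
    then have "real n / log 2 (real n) \<le> real n"
      using n by (simp add: divide_le_eq)
    then have "c * (real n / log 2 (real n)) \<le> c * real n"
      using c by (intro mult_left_mono) auto
    then have le: "ereal (c * (real n / log 2 (real n))) \<le> ereal (c * real n)" by simp
    show ?thesis
    proof (cases "n \<ge> N")
      case True
      have "c * real n \<le> 1 / 4 * real n" by (intro mult_right_mono) (auto simp: c_def)
      then have "ereal (c * real n) \<le> ereal (real n / 4)" by simp
      with le N[OF True] show ?thesis by (meson order_trans)
    next
      case False
      have "c * real n \<le> 1 / (real N + 1) * (real N + 1)"
        using False by (intro mult_mono) (auto simp: c_def)
      then have "ereal (c * real n) \<le> 1" by (simp add: one_ereal_def)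
      with le distortion_ge_1 show ?thesis unfolding diamond_distortion_def by (meson order_trans)
    qed
  qed
  with c diamond_distortion_binary_tree_le[OF assms] show ?thesis
    by (intro exI[of _ c]) auto
qed

end
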